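(* Assume the P-ideal dichotomy $\mathsf{PID}$. Then every $\omega_1$-tower is Hausdorff if and only if $\mathfrak b>\omega_1$.
   Context: For $A,B$ write $A\subseteq^* B$ if $A\setminus B$ is finite. An $\omega_1$-tower is a family $(T_\alpha)_{\alpha<\omega_1}$ of subsets of $\omega$ such that, for all $\alpha,\beta<\omega_1$, $T_\alpha\setminus T_\beta$ is finite if and only if $\alpha\le\beta$ (no maximality is assumed). A tower satisfies condition (H) if for each $\alpha<\omega_1$ and $n<\omega$ the set $\{\xi<\alpha : T_\xi\setminus T_\alpha\subseteq n\}$ is finite (here $n=\{0,\dots,n-1\}$). A tower is Hausdorff if it has a cofinal subtower satisfying (H), i.e. there is an uncountable $X\subseteq\omega_1$ such that $(T_\alpha)_{\alpha\in X}$, re-enumerated increasingly in order type $\omega_1$, satisfies (H). The cardinal $\mathfrak b$ is the minimal cardinality of a family in $\omega^\omega$ which is not $\le^*$-dominated by a single function. A P-ideal is an ideal $\mathcal I$ such that for every countable subfamily $\{I_n : n<\omega\}\subseteq\mathcal I$ there is $I\in\mathcal I$ with $I_n\subseteq^* I$ for all $n$. $\mathsf{PID}$ is the assertion: for every P-ideal $\mathcal I\subseteq[\omega_1]^{\le\omega}$ (of countable subsets of $\omega_1$, containing the finite sets), either there is an uncountable $K\subseteq\omega_1$ such that $[K]^\omega\subseteq\mathcal I$, or $\omega_1=\bigcup_{n<\omega}A_n$ where $A_n\cap I$ is finite for each $n<\omega$ and $I\in\mathcal I$. *)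

theory Defs
  imports Complex_Main "HOL-Library.Countable_Set_Type"
begin

unbundle cardinal_syntax

section \<open>The first uncountable ordinal as a type\<close>

typedef omega1 = "Field (cardSuc natLeq)"
proof -
  have "infinite (Field (cardSuc natLeq))"
    using cardSuc_finite[OF natLeq_Card_order] by (simp add: Field_natLeq)
  then show ?thesis
    by (metis finite.emptyI equals0I)
qed

lemma cardSuc_natLeq_wo_rel: "wo_rel (cardSuc natLeq)"
  using cardSuc_Card_order[OF natLeq_Card_order]
  unfolding card_order_on_def wo_rel_def by blast

instantiation omega1 :: wellorder
begin

definition less_eq_omega1 :: "omega1 \<Rightarrow> omega1 \<Rightarrow> bool" where
  "\<alpha> \<le> \<beta> \<longleftrightarrow> (Rep_omega1 \<alpha>, Rep_omega1 \<beta>) \<in> cardSuc natLeq"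

definition less_omega1 :: "omega1 \<Rightarrow> omega1 \<Rightarrow> bool" where
  "\<alpha> < \<beta> \<longleftrightarrow> \<alpha> \<le> \<beta> \<and> \<not> \<beta> \<le> (\<alpha>::omega1)"

instance
proof
  fix x y z :: omega1
  note wo = cardSuc_natLeq_wo_rel
  show "x < y \<longleftrightarrow> x \<le> y \<and> \<not> y \<le> x"
    by (rule less_omega1_def)
  show "x \<le> x"
    using wo_rel.REFL[OF wo] Rep_omega1[of x]
    by (simp add: less_eq_omega1_def refl_on_def)
  show "x \<le> z" if "x \<le> y" "y \<le> z"
    using that wo_rel.TRANS[OF wo] unfolding less_eq_omega1_def trans_def by blast
  show "x = y" if "x \<le> y" "y \<le> x"
    using that wo_rel.ANTISYM[OF wo] unfolding less_eq_omega1_def antisym_def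
    by (blast intro: Rep_omega1_inject[THEN iffD1])
  show "x \<le> y \<or> y \<le> x"
    using wo_rel.TOTALS[OF wo] Rep_omega1[of x] Rep_omega1[of y]
    by (simp add: less_eq_omega1_def)
next
  fix P :: "omega1 \<Rightarrow> bool" and a :: omega1
  assume step: "\<And>x. (\<And>y. y < x \<Longrightarrow> P y) \<Longrightarrow> P x"
  let ?R = "inv_image (cardSuc natLeq - Id) Rep_omega1"
  have "wf ?R"
    using wo_rel.WF[OF cardSuc_natLeq_wo_rel] by simp
  moreover have "(y, x) \<in> ?R" if "y < x" for x y
    using that by (auto simp: less_omega1_def less_eq_omega1_def)
  ultimately have "wf {(y, x::omega1). y < x}"
    by (metis (no_types, lifting) case_prodE mem_Collect_eq subsetI wf_subset)
  then show "P a"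
    by (induction a rule: wf_induct_rule) (use step in blast)
qed

end

lemma countable_below_omega1: "countable {..<\<alpha>::omega1}"
proof -
  have "Rep_omega1 ` {..<\<alpha>} \<subseteq> underS (cardSuc natLeq) (Rep_omega1 \<alpha>)"
    by (force simp: underS_def less_omega1_def less_eq_omega1_def)
  moreover have "|underS (cardSuc natLeq) (Rep_omega1 \<alpha>)| \<le>o natLeq"
    using card_of_underS[OF cardSuc_Card_order[OF natLeq_Card_order] Rep_omega1]
    by (simp add: cardSuc_ordLeq_ordLess natLeq_Card_order card_of_Card_order)
  ultimately have "countable (Rep_omega1 ` {..<\<alpha>})"
    by (meson countable_card_le_natLeq countable_subset)
  then show ?thesis
    by (meson Rep_omega1_inject countable_image_inj_on inj_onI)
qed

lemma card_of_omega1: "|UNIV :: omega1 set| =o cardSuc natLeq"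
proof -
  have "bij_betw Rep_omega1 UNIV (Field (cardSuc natLeq))"
    using type_definition.Rep_range[OF type_definition_omega1]
    by (auto simp: bij_betw_def inj_on_def Rep_omega1_inject)
  then have "|UNIV :: omega1 set| =o |Field (cardSuc natLeq)|"
    using card_of_ordIso by blast
  then show ?thesis
    using card_of_Field_ordIso[OF cardSuc_Card_order[OF natLeq_Card_order]]
    by (rule ordIso_transitive)
qed

lemma uncountable_omega1: "uncountable (UNIV :: omega1 set)"
proof -
  have "natLeq <o |UNIV :: omega1 set|"
    using cardSuc_greater[OF natLeq_Card_order] card_of_omega1
      ordIso_symmetric ordLess_ordIso_trans by blast
  then show ?thesis
    by (simp add: countable_card_le_natLeq not_ordLeq_iff_ordLess
        natLeq_Well_order card_of_Well_order)
qed



section \<open>Towers\<close>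

definition omega1_tower :: "(omega1 \<Rightarrow> nat set) \<Rightarrow> bool" where
  "omega1_tower T \<longleftrightarrow> (\<forall>\<alpha> \<beta>. finite (T \<alpha> - T \<beta>) \<longleftrightarrow> \<alpha> \<le> \<beta>)"

definition condition_H :: "(omega1 \<Rightarrow> nat set) \<Rightarrow> bool" where
  "condition_H T \<longleftrightarrow> (\<forall>\<alpha> n. finite {\<xi>. \<xi> < \<alpha> \<and> T \<xi> - T \<alpha> \<subseteq> {..<n}})"

text \<open>The increasing enumeration \<open>e\<close> below exists for every uncountable \<open>X\<close>, see
  \<open>uncountable_omega1_enumeration\<close>; it is the unique order isomorphism between the
  well-orders \<open>omega1\<close> and \<open>X\<close>.\<close>

definition hausdorff_tower :: "(omega1 \<Rightarrow> nat set) \<Rightarrow> bool" where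
  "hausdorff_tower T \<longleftrightarrow>
     (\<exists>X. uncountable X \<and>
        (\<exists>e :: omega1 \<Rightarrow> omega1. strict_mono e \<and> range e = X \<and> condition_H (\<lambda>\<alpha>. T (e \<alpha>))))"

lemma uncountable_omega1_enumeration:
  fixes X :: "omega1 set"
  assumes "uncountable X"
  shows "\<exists>e :: omega1 \<Rightarrow> omega1. strict_mono e \<and> range e = X"
proof -
  define F where "F = (\<lambda>(e :: omega1 \<Rightarrow> omega1) \<alpha>. LEAST x. x \<in> X - e ` {..<\<alpha>})"
  define e where "e = wfrec {(y, x :: omega1). y < x} F"
  have e_eq: "e \<alpha> = (LEAST x. x \<in> X - e ` {..<\<alpha>})" for \<alpha>
  proof -
    have "e \<alpha> = F (cut e {(y, x). y < x} \<alpha>) \<alpha>"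
      unfolding e_def by (rule wfrec) (rule wf)
    also have "\<dots> = F e \<alpha>"
      by (auto simp: F_def cut_def image_iff cong: conj_cong intro!: arg_cong[where f = Least] ext)
    finally show ?thesis by (simp add: F_def)
  qed
  have ne: "\<exists>x. x \<in> X - e ` {..<\<alpha>}" for \<alpha>
    using assms countable_below_omega1[of \<alpha>]
    by (metis countable_image countable_subset subsetI DiffI)
  have e_in: "e \<alpha> \<in> X - e ` {..<\<alpha>}" for \<alpha>
    using LeastI_ex[OF ne[of \<alpha>]] e_eq[of \<alpha>] by simp
  have e_le: "e \<alpha> \<le> x" if "x \<in> X - e ` {..<\<alpha>}" for \<alpha> x
    using Least_le[of "\<lambda>x. x \<in> X - e ` {..<\<alpha>}", OF that] e_eq[of \<alpha>] by simp
  have mono: "strict_mono e"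
  proof (rule strict_monoI)
    fix \<alpha> \<beta> :: omega1 assume "\<alpha> < \<beta>"
    then have "e \<alpha> \<in> e ` {..<\<beta>}" "e ` {..<\<alpha>} \<subseteq> e ` {..<\<beta>}"
      by auto
    then have "e \<beta> \<in> X - e ` {..<\<alpha>}" "e \<alpha> \<noteq> e \<beta>"
      using e_in[of \<beta>] by (blast, metis DiffD2)
    then show "e \<alpha> < e \<beta>" using e_le[of "e \<beta>" \<alpha>] by simp
  qed
  have "x \<in> range e" if "x \<in> X" for x
  proof (rule ccontr)
    assume "x \<notin> range e"
    then have "e \<alpha> \<le> x" for \<alpha> using that e_le[of x \<alpha>] by blast
    then have "range e \<subseteq> {..<x}"
      using \<open>x \<notin> range e\<close> by (auto simp: order_less_le)
    then have "countable (range e)"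
      using countable_below_omega1 countable_subset by blast
    then show False
      using uncountable_omega1 countable_image_inj_on strict_mono_imp_inj_on[OF mono] by blast
  qed
  then have "range e = X" using e_in by blast
  with mono show ?thesis by blast
qed


section \<open>The bounding number\<close>

definition unbounded_family :: "(nat \<Rightarrow> nat) set \<Rightarrow> bool" where
  "unbounded_family F \<longleftrightarrow> \<not> (\<exists>g. \<forall>f\<in>F. \<forall>\<^sub>F n in sequentially. f n \<le> g n)"

definition bounding_number :: "(nat \<Rightarrow> nat) rel" where
  "bounding_number =
     |SOME F. unbounded_family F \<and> (\<forall>G. unbounded_family G \<longrightarrow> |F| \<le>o |G| )|"

lemma unbounded_family_UNIV: "unbounded_family UNIV"
  unfolding unbounded_family_def
proof
  assume "\<exists>g :: nat \<Rightarrow> nat. \<forall>f\<in>UNIV. \<forall>\<^sub>F n in sequentially. f n \<le> g n"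
  then obtain g :: "nat \<Rightarrow> nat" where "\<forall>\<^sub>F n in sequentially. Suc (g n) \<le> g n"
    by (meson UNIV_I)
  then show False by simp
qed

lemma bounding_number_witness:
  obtains F where "unbounded_family F" "bounding_number = |F|"
    "\<And>G. unbounded_family G \<Longrightarrow> |F| \<le>o |G|"
proof -
  have "\<exists>F. unbounded_family F \<and> (\<forall>G. unbounded_family G \<longrightarrow> |F| \<le>o |G| )"
    using exists_minim_Card_order[of "card_of ` Collect unbounded_family"]
      unbounded_family_UNIV card_of_Card_order by blast
  from someI_ex[OF this] show thesis
    using that unfolding bounding_number_def by blast
qed


section \<open>The P-ideal dichotomy\<close>

definition almost_subset :: "'a set \<Rightarrow> 'a set \<Rightarrow> bool"  (infix "\<subseteq>\<^sup>*" 50) where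
  "A \<subseteq>\<^sup>* B \<longleftrightarrow> finite (A - B)"

definition set_ideal :: "'a set set \<Rightarrow> bool" where
  "set_ideal \<I> \<longleftrightarrow> {} \<in> \<I> \<and> (\<forall>A\<in>\<I>. \<forall>B. B \<subseteq> A \<longrightarrow> B \<in> \<I>) \<and> (\<forall>A\<in>\<I>. \<forall>B\<in>\<I>. A \<union> B \<in> \<I>)"

definition P_ideal :: "'a set set \<Rightarrow> bool" where
  "P_ideal \<I> \<longleftrightarrow> set_ideal \<I> \<and>
     (\<forall>J :: nat \<Rightarrow> 'a set. range J \<subseteq> \<I> \<longrightarrow> (\<exists>I\<in>\<I>. \<forall>n. J n \<subseteq>\<^sup>* I))"

definition PID :: bool where
  "PID \<longleftrightarrow>
     (\<forall>\<I> :: omega1 set set.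
        P_ideal \<I> \<and> (\<forall>I\<in>\<I>. countable I) \<and> (\<forall>I. finite I \<longrightarrow> I \<in> \<I>) \<longrightarrow>
          (\<exists>K. uncountable K \<and> (\<forall>I. I \<subseteq> K \<and> countable I \<and> infinite I \<longrightarrow> I \<in> \<I>)) \<or>
          (\<exists>A :: nat \<Rightarrow> omega1 set. UNIV = (\<Union>n. A n) \<and> (\<forall>n. \<forall>I\<in>\<I>. finite (A n \<inter> I))))"

end

theory Submission
  imports Defs
begin

text \<open>
  Write \<open>\<xi> \<le>\<^sub>n \<beta>\<close> for \<open>T \<xi> - T \<beta> \<subseteq> {..<n}\<close>. For a tower each \<open>\<le>\<^sub>n\<close> is a partial order contained
  in the order of \<open>omega1\<close>, it grows with \<open>n\<close>, and condition (H) says that every \<open>\<alpha>\<close> has finitely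
  many \<open>\<le>\<^sub>n\<close>-predecessors. The hypothesis \<open>\<bb> > \<omega>\<^sub>1\<close> is used in the form that no family of functions
  indexed by \<open>omega1\<close> is unbounded (\<open>omega1_less_bounding_number_iff\<close>).

  Suppose \<open>\<bb> > \<omega>\<^sub>1\<close> and let \<open>\<I>\<close> consist of the countable \<open>B\<close> that have finite intersection with the
  \<open>\<le>\<^sub>m\<close>-predecessors of \<open>\<beta>\<close>, for all \<open>\<beta>\<close> and \<open>m\<close>. A diagonal union, thinned out by a function that
  dominates \<open>\<omega>\<^sub>1\<close> many others, shows that \<open>\<I>\<close> is a P-ideal (\<open>P_ideal_dispersed\<close>). If all countable
  subsets of an uncountable \<open>K\<close> are in \<open>\<I>\<close>, then \<open>K\<close> is a subtower with (H). The second alternative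
  of the dichotomy yields an uncountable \<open>A\<close> without infinite subsets in \<open>\<I>\<close>; there is no such \<open>A\<close>.
  Indeed, for each fixed \<open>n\<close> there is a sequence in \<open>A\<close> that no \<open>\<beta> \<in> A\<close> bounds infinitely often in
  \<open>\<le>\<^sub>n\<close> (\<open>exists_escaping_sequence\<close>): otherwise increasing chains have upper bounds, so by Zorn's
  lemma the \<open>\<le>\<^sub>n\<close>-maximal elements of \<open>A\<close> are cofinal, and infinitely many maximal elements are never
  bounded by one \<open>\<beta>\<close>. Since \<open>\<bb> > \<omega>\<^sub>1\<close>, one can choose one term from the \<open>n\<close>-th sequence for each \<open>n\<close> so
  that the result works for all \<open>n\<close> at once (\<open>exists_infinite_dispersed\<close>).

  Suppose \<open>\<bb> \<le> \<omega>\<^sub>1\<close>. There is an unbounded sequence \<open>(f\<^sub>\<alpha>)\<close> of monotone functions that increases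
  strictly modulo finite. The regions below the graphs form a tower, and a classical argument of
  Todorcevic shows that every uncountable set of indices contains \<open>\<xi> < \<alpha>\<close> with \<open>f\<^sub>\<xi> \<le> f\<^sub>\<alpha>\<close>
  everywhere (\<open>unbounded_scale_no_uncountable_antichain\<close>). A Hausdorff tower, however, contains an
  uncountable antichain for inclusion (\<open>hausdorff_tower_uncountable_antichain\<close>): in (H) with
  \<open>n = 0\<close> each index is comparable to finitely many smaller ones, so a greedy colouring uses
  countably many colours.
\<close>

section \<open>Uncountable sets and families of functions indexed by \<open>omega1\<close>\<close>

lemma countable_atMost_omega1: "countable {..\<alpha>::omega1}"
  using countable_below_omega1[of \<alpha>] by (simp add: ivl_disj_un_singleton(2)[symmetric])

lemma uncountable_omega1_cofinal:
  fixes A :: "omega1 set"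
  assumes "uncountable A"
  obtains \<beta> where "\<beta> \<in> A" "\<alpha> < \<beta>"
proof -
  have "\<not> A \<subseteq> {..\<alpha>}"
    using assms countable_atMost_omega1 countable_subset by blast
  then obtain \<beta> where "\<beta> \<in> A" "\<not> \<beta> \<le> \<alpha>" by blast
  then show thesis using that by (simp add: not_le)
qed

lemma countable_omega1_bounded:
  fixes D :: "omega1 set"
  assumes "countable D"
  obtains \<gamma> where "\<And>\<xi>. \<xi> \<in> D \<Longrightarrow> \<xi> < \<gamma>"
proof -
  have "countable (\<Union>\<xi>\<in>D. {..\<xi>})"
    using assms countable_atMost_omega1 by blast
  then obtain \<gamma> where "\<gamma> \<notin> (\<Union>\<xi>\<in>D. {..\<xi>})"
    using uncountable_omega1 by (metis UNIV_I countable_subset subsetI)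
  then show thesis using that by (auto simp: not_le)
qed

lemma omega1_less_bounding_number_iff:
  "cardSuc natLeq <o bounding_number \<longleftrightarrow>
     (\<forall>\<phi> :: omega1 \<Rightarrow> nat \<Rightarrow> nat. \<not> unbounded_family (range \<phi>))"
proof -
  obtain F where F: "unbounded_family F" "bounding_number = |F|"
    "\<And>G. unbounded_family G \<Longrightarrow> |F| \<le>o |G|"
    by (rule bounding_number_witness) blast
  have "cardSuc natLeq <o |F| \<longleftrightarrow> \<not> |F| \<le>o cardSuc natLeq"
    using not_ordLeq_iff_ordLess card_of_Well_order
      cardSuc_Card_order[OF natLeq_Card_order] card_order_on_def by blast
  also have "|F| \<le>o cardSuc natLeq \<longleftrightarrow> |F| \<le>o |UNIV :: omega1 set|"
    using ordLeq_ordIso_trans[OF _ card_of_omega1]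
      ordLeq_ordIso_trans[OF _ ordIso_symmetric[OF card_of_omega1]] by blast
  also have "\<dots> \<longleftrightarrow> (\<exists>\<phi> :: omega1 \<Rightarrow> nat \<Rightarrow> nat. unbounded_family (range \<phi>))"
  proof
    assume le: "|F| \<le>o |UNIV :: omega1 set|"
    have "F \<noteq> {}" using F(1) by (auto simp: unbounded_family_def)
    then obtain \<phi> :: "omega1 \<Rightarrow> nat \<Rightarrow> nat" where "range \<phi> = F"
      using le card_of_ordLeq2[of F "UNIV :: omega1 set"] by auto
    then show "\<exists>\<phi> :: omega1 \<Rightarrow> nat \<Rightarrow> nat. unbounded_family (range \<phi>)" using F(1) by blast
  next
    assume "\<exists>\<phi> :: omega1 \<Rightarrow> nat \<Rightarrow> nat. unbounded_family (range \<phi>)"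
    then show "|F| \<le>o |UNIV :: omega1 set|"
      by (metis F(3) card_of_image ordLeq_transitive)
  qed
  finally show ?thesis using F(2) by simp
qed

section \<open>Escaping sequences in uncountable subsets of a tower\<close>

lemma tower_finite_diff_iff:
  "omega1_tower T \<Longrightarrow> finite (T \<alpha> - T \<beta>) \<longleftrightarrow> \<alpha> \<le> \<beta>"
  by (simp add: omega1_tower_def)

lemma tower_diff_bounded_imp_le:
  assumes "omega1_tower T" "T \<alpha> - T \<beta> \<subseteq> {..<n}"
  shows "\<alpha> \<le> \<beta>"
  using assms finite_subset tower_finite_diff_iff by blast

text \<open>
  Removing \<open>{..<n}\<close> from every member turns \<open>\<le>\<^sub>n\<close> into inclusion. If the conclusion fails, the union
  of a chain of such sets is approximated by a sequence of its members, and a bound for infinitely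
  many of these contains the whole union; so Zorn's lemma applies. A maximal member is contained in
  no other, which makes any injective sequence of maximal members escape.
\<close>

lemma exists_escaping_sequence:
  assumes T: "omega1_tower T" and A: "uncountable A"
  shows "\<exists>e :: nat \<Rightarrow> omega1. range e \<subseteq> A \<and> (\<forall>\<beta>\<in>A. finite {k. T (e k) - T \<beta> \<subseteq> {..<n}})"
proof (rule ccontr)
  define S where "S \<xi> = T \<xi> - {..<n}" for \<xi>
  have S_iff: "T \<xi> - T \<beta> \<subseteq> {..<n} \<longleftrightarrow> S \<xi> \<subseteq> S \<beta>" for \<xi> \<beta>
    by (auto simp: S_def)
  have S_le: "\<xi> \<le> \<beta>" if "S \<xi> \<subseteq> S \<beta>" for \<xi> \<beta>
    using that tower_diff_bounded_imp_le[OF T] S_iff by blast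
  assume "\<not> ?thesis"
  then have bounded: "\<exists>\<beta>\<in>A. infinite {k. S (e k) \<subseteq> S \<beta>}" if "range e \<subseteq> A" for e :: "nat \<Rightarrow> omega1"
    using that by (auto simp: S_iff)
  define M where "M = {m\<in>A. \<forall>x\<in>A. S m \<subseteq> S x \<longrightarrow> S x = S m}"
  have above: "\<exists>m\<in>M. S a \<subseteq> S m" if a: "a \<in> A" for a
  proof -
    define \<X> where "\<X> = {S x | x. x \<in> A \<and> S a \<subseteq> S x}"
    have "\<exists>U\<in>\<X>. \<forall>X\<in>C. X \<subseteq> U" if C: "subset.chain \<X> C" for C
    proof (cases "C = {}")
      case True
      then show ?thesis using a by (auto simp: \<X>_def)
    next
      case False
      have "\<exists>x\<in>A. \<Union>C \<inter> {..<k} \<subseteq> S x" for k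
      proof -
        obtain X where "X \<in> C" "\<Union>C \<inter> {..<k} \<subseteq> X"
          using finite_subset_Union_chain[of "\<Union>C \<inter> {..<k}" C \<X>] C False by auto
        moreover have "X \<in> \<X>" using C \<open>X \<in> C\<close> by (auto simp: subset.chain_def)
        ultimately show ?thesis unfolding \<X>_def by blast
      qed
      then obtain e where e: "\<And>k. e k \<in> A" "\<And>k. \<Union>C \<inter> {..<k} \<subseteq> S (e k)"
        by metis
      then obtain \<beta> where \<beta>: "\<beta> \<in> A" "infinite {k. S (e k) \<subseteq> S \<beta>}"
        using bounded[of e] by blast
      have "\<Union>C \<subseteq> S \<beta>"
      proof
        fix x assume "x \<in> \<Union>C"
        moreover obtain k where "k > x" "S (e k) \<subseteq> S \<beta>"
          using \<beta>(2) by (auto simp: infinite_nat_iff_unbounded)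
        ultimately show "x \<in> S \<beta>" using e(2)[of k] by blast
      qed
      moreover have "S \<beta> \<in> \<X>"
      proof -
        obtain X where X: "X \<in> C" using False by blast
        then have "X \<in> \<X>" using C by (auto simp: subset.chain_def)
        then have "S a \<subseteq> X" by (auto simp: \<X>_def)
        then have "S a \<subseteq> S \<beta>" using X \<open>\<Union>C \<subseteq> S \<beta>\<close> by blast
        then show ?thesis using \<beta>(1) by (auto simp: \<X>_def)
      qed
      ultimately show ?thesis by blast
    qed
    then obtain X where "X \<in> \<X>" "\<forall>Y\<in>\<X>. X \<subseteq> Y \<longrightarrow> Y = X"
      using subset_Zorn[of \<X>] by blast
    moreover from this obtain m where m: "m \<in> A" "X = S m" "S a \<subseteq> S m"
      by (auto simp: \<X>_def)
    moreover have "S x \<in> \<X>" if "x \<in> A" "S m \<subseteq> S x" for x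
      using that m(3) by (auto simp: \<X>_def)
    ultimately have "m \<in> M" by (simp add: M_def)
    then show ?thesis using m(3) by blast
  qed
  have "infinite M"
  proof
    assume "finite M"
    then have "countable (\<Union>m\<in>M. {..m})"
      using countable_atMost_omega1 by (simp add: countable_finite)
    moreover have "A \<subseteq> (\<Union>m\<in>M. {..m})"
      using above S_le by blast
    ultimately show False using A countable_subset by blast
  qed
  then obtain e :: "nat \<Rightarrow> omega1" where e: "inj e" "range e \<subseteq> M"
    using infinite_countable_subset by blast
  then obtain \<beta> where \<beta>: "\<beta> \<in> A" "infinite {k. S (e k) \<subseteq> S \<beta>}"
    using bounded[of e] by (auto simp: M_def)
  have "{k. S (e k) \<subseteq> S \<beta>} \<subseteq> e -` {\<beta>}"
  proof
    fix k assume "k \<in> {k. S (e k) \<subseteq> S \<beta>}"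
    moreover have "e k \<in> M" using e(2) by blast
    ultimately have "S \<beta> = S (e k)"
      using \<beta>(1) by (auto simp: M_def)
    then show "k \<in> e -` {\<beta>}" using S_le by (simp add: order.antisym)
  qed
  moreover have "finite (e -` {\<beta>})"
    using e(1) by (simp add: finite_vimageI)
  ultimately show False using \<beta>(2) by (meson finite_subset)
qed

section \<open>The ideal of dispersed sets\<close>

text \<open>
  For a tower only \<open>\<xi> \<le> \<beta>\<close> can satisfy the condition below, so this is (H) for \<open>B\<close>, but tested
  against every \<open>\<beta>\<close> instead of the members of \<open>B\<close>; this makes the property pass to unions of
  two sets.
\<close>

definition dispersed :: "(omega1 \<Rightarrow> nat set) \<Rightarrow> omega1 set \<Rightarrow> bool" where
  "dispersed T B \<longleftrightarrow> countable B \<and> (\<forall>\<beta> m. finite {\<xi>\<in>B. T \<xi> - T \<beta> \<subseteq> {..<m}})"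

lemma dispersedD: "dispersed T B \<Longrightarrow> finite {\<xi>\<in>B. T \<xi> - T \<beta> \<subseteq> {..<m}}"
  by (simp add: dispersed_def)

lemma eventually_le_of_not_unbounded:
  assumes "\<not> unbounded_family (range \<phi>)"
  obtains g where "\<And>\<beta>. \<exists>N. \<forall>n\<ge>N. \<phi> \<beta> n \<le> g n"
  using assms by (auto simp: unbounded_family_def eventually_sequentially)

text \<open>
  The sequence for a fixed \<open>n\<close> escapes from each \<open>\<beta>\<close> after some index; a function dominating all
  these indices selects one term for each \<open>n\<close>. Almost all of the selected terms come from
  \<open>n \<ge> m\<close> and so escape in \<open>\<le>\<^sub>m\<close> as well.
\<close>

lemma exists_infinite_dispersed:
  assumes T: "omega1_tower T" and A: "uncountable A"
    and bounded: "\<And>\<phi> :: omega1 \<Rightarrow> nat \<Rightarrow> nat. \<not> unbounded_family (range \<phi>)"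
  shows "\<exists>B\<subseteq>A. infinite B \<and> dispersed T B"
proof -
  obtain e where e: "\<And>n. range (e n) \<subseteq> A"
    "\<And>n \<beta>. \<beta> \<in> A \<Longrightarrow> finite {k :: nat. T (e n k) - T \<beta> \<subseteq> {..<n}}"
    using exists_escaping_sequence[OF T A] by metis
  have "\<exists>N. \<forall>k\<ge>N. \<not> T (e n k) - T \<beta> \<subseteq> {..<n}" if "\<beta> \<in> A" for n \<beta>
    using e(2)[OF that, of n] by (auto simp: finite_nat_set_iff_bounded not_less) (meson leD)
  then obtain \<phi> where \<phi>: "\<And>n \<beta> k. \<beta> \<in> A \<Longrightarrow> k \<ge> \<phi> \<beta> n \<Longrightarrow> \<not> T (e n k) - T \<beta> \<subseteq> {..<n}"
    by metis
  obtain g where g: "\<And>\<beta>. \<exists>N. \<forall>n\<ge>N. \<phi> \<beta> n \<le> g n"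
    using eventually_le_of_not_unbounded[OF bounded[of \<phi>]] by blast
  define s where "s n = e n (g n)" for n
  have s_A: "s n \<in> A" for n using e(1) by (auto simp: s_def)
  have fin_A: "finite {n. T (s n) - T \<beta> \<subseteq> {..<m}}" if \<beta>: "\<beta> \<in> A" for \<beta> m
  proof -
    obtain N where N: "\<forall>n\<ge>N. \<phi> \<beta> n \<le> g n" using g by blast
    have "n < max N m" if "T (s n) - T \<beta> \<subseteq> {..<m}" for n
    proof (rule ccontr)
      assume "\<not> n < max N m"
      then have "\<phi> \<beta> n \<le> g n" "{..<m} \<subseteq> {..<n}" using N by auto
      then show False using \<phi>[OF \<beta>, of n "g n"] that by (auto simp: s_def)
    qed
    then show ?thesis
      by (auto simp: finite_nat_set_iff_bounded)
  qed
  \<comment> \<open>It suffices to escape from a cofinal set of \<open>\<beta>\<close>, because members of a tower increase modulo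
    finite; the finite error only enlarges \<open>m\<close>.\<close>
  have fin: "finite {n. T (s n) - T \<beta> \<subseteq> {..<m}}" for \<beta> m
  proof -
    obtain \<gamma> where \<gamma>: "\<gamma> \<in> A" "\<beta> < \<gamma>" using uncountable_omega1_cofinal[OF A] by blast
    then have "finite (T \<beta> - T \<gamma>)" using tower_finite_diff_iff[OF T] by simp
    then obtain k where "T \<beta> - T \<gamma> \<subseteq> {..<k}"
      by (auto simp: finite_nat_set_iff_bounded)
    then have "T (s n) - T \<gamma> \<subseteq> {..<max m k}" if "T (s n) - T \<beta> \<subseteq> {..<m}" for n
    proof -
      have "T (s n) - T \<gamma> \<subseteq> {..<m} \<union> {..<k}"
        using that \<open>T \<beta> - T \<gamma> \<subseteq> {..<k}\<close> by blast
      then show ?thesis by auto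
    qed
    then show ?thesis
      by (intro finite_subset[OF _ fin_A[OF \<gamma>(1), of "max m k"]] Collect_mono impI)
  qed
  \<comment> \<open>A value taken infinitely often would not escape from itself.\<close>
  have "infinite (range s)"
  proof
    assume "finite (range s)"
    then obtain n where "infinite {k. s k = s n}"
      using pigeonhole_infinite[of "UNIV :: nat set" s] by auto
    moreover have "finite {k. s k = s n}"
      by (rule finite_subset[OF _ fin[of "s n" 0]]) auto
    ultimately show False by blast
  qed
  moreover have "finite {\<xi> \<in> range s. T \<xi> - T \<beta> \<subseteq> {..<m}}" for \<beta> m
    by (rule finite_surj[OF fin[of \<beta> m], of _ s]) auto
  then have "dispersed T (range s)" by (simp add: dispersed_def)
  ultimately show ?thesis using s_A by blast
qed

lemma set_ideal_dispersed: "set_ideal (Collect (dispersed T))"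
  unfolding set_ideal_def
proof (intro conjI ballI allI impI)
  show "{} \<in> Collect (dispersed T)" by (simp add: dispersed_def)
next
  fix A B assume A: "A \<in> Collect (dispersed T)" and B: "B \<subseteq> A"
  have "finite {\<xi>\<in>B. T \<xi> - T \<beta> \<subseteq> {..<m}}" for \<beta> m
    by (rule finite_subset[OF _ dispersedD[of T A \<beta> m]]) (use A B in auto)
  then show "B \<in> Collect (dispersed T)"
    using A countable_subset[OF B] by (simp add: dispersed_def)
next
  fix A B assume AB: "A \<in> Collect (dispersed T)" "B \<in> Collect (dispersed T)"
  have "{\<xi>\<in>A \<union> B. T \<xi> - T \<beta> \<subseteq> {..<m}} =
      {\<xi>\<in>A. T \<xi> - T \<beta> \<subseteq> {..<m}} \<union> {\<xi>\<in>B. T \<xi> - T \<beta> \<subseteq> {..<m}}" for \<beta> m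
    by auto
  then show "A \<union> B \<in> Collect (dispersed T)"
    using AB by (simp add: dispersed_def)
qed

text \<open>
  To bound all \<open>J n\<close> modulo finite, remove from \<open>J n\<close> an initial segment, with respect to an
  enumeration, that contains the \<open>\<le>\<^sub>n\<close>-predecessors of \<open>\<beta>\<close>. The length depends on \<open>\<beta>\<close>; a function
  dominating the lengths for all \<open>\<beta>\<close> is correct for each \<open>\<beta>\<close> from some \<open>n\<close> on.
\<close>

lemma P_ideal_dispersed:
  assumes bounded: "\<And>\<phi> :: omega1 \<Rightarrow> nat \<Rightarrow> nat. \<not> unbounded_family (range \<phi>)"
  shows "P_ideal (Collect (dispersed T))"
  unfolding P_ideal_def
proof (intro conjI allI impI)
  show "set_ideal (Collect (dispersed T))" by (rule set_ideal_dispersed)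
next
  fix J :: "nat \<Rightarrow> omega1 set"
  assume "range J \<subseteq> Collect (dispersed T)"
  then have J: "dispersed T (J n)" for n by blast
  then have cJ: "countable (J n)" for n by (simp add: dispersed_def)
  define ix where "ix n = to_nat_on (J n)" for n
  have inj: "inj_on (ix n) (J n)" for n
    using inj_on_to_nat_on[OF cJ] by (simp add: ix_def)
  have "\<exists>N. \<forall>\<xi>\<in>J n. T \<xi> - T \<beta> \<subseteq> {..<n} \<longrightarrow> ix n \<xi> < N" for n \<beta>
    using finite_imageI[OF dispersedD[OF J[of n], of \<beta> n], of "ix n"]
    by (auto simp: finite_nat_set_iff_bounded)
  then have "\<forall>\<beta> n. \<exists>N. \<forall>\<xi>\<in>J n. T \<xi> - T \<beta> \<subseteq> {..<n} \<longrightarrow> ix n \<xi> < N" by blast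
  then obtain \<phi> where \<phi>: "\<And>\<beta> n \<xi>. \<xi> \<in> J n \<Longrightarrow> T \<xi> - T \<beta> \<subseteq> {..<n} \<Longrightarrow> ix n \<xi> < \<phi> \<beta> n"
    unfolding choice_iff by blast
  obtain g where g: "\<And>\<beta>. \<exists>N. \<forall>n\<ge>N. \<phi> \<beta> n \<le> g n"
    using eventually_le_of_not_unbounded[OF bounded[of \<phi>]] by blast
  define I where "I = (\<Union>n. {\<xi>\<in>J n. g n \<le> ix n \<xi>})"
  have "finite {\<xi>\<in>I. T \<xi> - T \<beta> \<subseteq> {..<m}}" for \<beta> m
  proof -
    obtain N where N: "\<forall>n\<ge>N. \<phi> \<beta> n \<le> g n" using g by blast
    have "{\<xi>\<in>I. T \<xi> - T \<beta> \<subseteq> {..<m}} \<subseteq> (\<Union>n<max N m. {\<xi>\<in>J n. T \<xi> - T \<beta> \<subseteq> {..<m}})"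
    proof
      fix \<xi> assume "\<xi> \<in> {\<xi>\<in>I. T \<xi> - T \<beta> \<subseteq> {..<m}}"
      then obtain n where n: "\<xi> \<in> J n" "g n \<le> ix n \<xi>" "T \<xi> - T \<beta> \<subseteq> {..<m}"
        by (auto simp: I_def)
      have "n < max N m"
      proof (rule ccontr)
        assume "\<not> n < max N m"
        then have "\<phi> \<beta> n \<le> g n" "{..<m} \<subseteq> {..<n}" using N by auto
        then show False using \<phi>[OF n(1), of \<beta>] n(2,3) by (meson leD le_trans subset_trans)
      qed
      then show "\<xi> \<in> (\<Union>n<max N m. {\<xi>\<in>J n. T \<xi> - T \<beta> \<subseteq> {..<m}})" using n by blast
    qed
    then show ?thesis
      by (rule finite_subset) (intro finite_UN_I finite_lessThan dispersedD J)
  qed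
  moreover have "countable I" using cJ by (auto simp: I_def)
  moreover have "J n \<subseteq>\<^sup>* I" for n
  proof -
    have "ix n ` (J n - I) \<subseteq> {..<g n}" by (auto simp: I_def not_le)
    then have "finite (ix n ` (J n - I))" by (rule finite_subset) simp
    then show ?thesis
      unfolding almost_subset_def
      by (rule finite_imageD[OF _ inj_on_subset[OF inj Diff_subset]])
  qed
  ultimately show "\<exists>I\<in>Collect (dispersed T). \<forall>n. J n \<subseteq>\<^sup>* I"
    by (auto simp: dispersed_def)
qed

lemma hausdorff_tower_of_PID:
  assumes PID: "PID" and T: "omega1_tower T"
    and bounded: "\<And>\<phi> :: omega1 \<Rightarrow> nat \<Rightarrow> nat. \<not> unbounded_family (range \<phi>)"
  shows "hausdorff_tower T"
proof -
  let ?\<I> = "Collect (dispersed T)"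
  have "P_ideal ?\<I> \<and> (\<forall>I\<in>?\<I>. countable I) \<and> (\<forall>I. finite I \<longrightarrow> I \<in> ?\<I>)"
    using P_ideal_dispersed[OF bounded] by (auto simp: dispersed_def countable_finite)
  then have "(\<exists>K. uncountable K \<and> (\<forall>I. I \<subseteq> K \<and> countable I \<and> infinite I \<longrightarrow> I \<in> ?\<I>)) \<or>
      (\<exists>A :: nat \<Rightarrow> omega1 set. UNIV = (\<Union>n. A n) \<and> (\<forall>n. \<forall>I\<in>?\<I>. finite (A n \<inter> I)))"
    by (rule PID[unfolded PID_def, rule_format])
  then consider
      K where "uncountable K" "\<And>I. I \<subseteq> K \<Longrightarrow> countable I \<Longrightarrow> infinite I \<Longrightarrow> I \<in> ?\<I>"
    | A :: "nat \<Rightarrow> omega1 set" where "UNIV = (\<Union>n. A n)" "\<And>n I. I \<in> ?\<I> \<Longrightarrow> finite (A n \<inter> I)"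
    by meson
  then show ?thesis
  proof cases
    case 1
    obtain e :: "omega1 \<Rightarrow> omega1" where e: "strict_mono e" "range e = K"
      using uncountable_omega1_enumeration[OF 1(1)] by blast
    have "finite {\<xi>. \<xi> < \<alpha> \<and> T (e \<xi>) - T (e \<alpha>) \<subseteq> {..<n}}" (is "finite ?P") for \<alpha> n
    proof (rule ccontr)
      assume inf: "infinite ?P"
      have inj: "inj_on e ?P"
        using strict_mono_imp_inj_on[OF e(1)] inj_on_subset by blast
      have "countable ?P"
        by (rule countable_subset[OF _ countable_below_omega1[of \<alpha>]]) auto
      then have "e ` ?P \<in> ?\<I>"
        using 1(2)[of "e ` ?P"] e(2) inf finite_image_iff[OF inj] by blast
      then have "finite {\<xi> \<in> e ` ?P. T \<xi> - T (e \<alpha>) \<subseteq> {..<n}}"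
        using dispersedD by blast
      moreover have "{\<xi> \<in> e ` ?P. T \<xi> - T (e \<alpha>) \<subseteq> {..<n}} = e ` ?P" by auto
      ultimately show False using inf finite_image_iff[OF inj] by simp
    qed
    then have "condition_H (\<lambda>\<alpha>. T (e \<alpha>))" by (simp add: condition_H_def)
    then show ?thesis using 1(1) e by (auto simp: hausdorff_tower_def)
  next
    case 2
    obtain n where "uncountable (A n)"
      using 2(1) uncountable_omega1 countable_UN[of UNIV A] by auto
    then obtain B where "B \<subseteq> A n" "infinite B" "dispersed T B"
      using exists_infinite_dispersed[OF T _ bounded] by blast
    then show ?thesis using 2(2)[of B n] by (simp add: Int_absorb1)
  qed
qed

section \<open>Hausdorff towers contain uncountable antichains\<close>

text \<open>
  A graph on a well-order in which every vertex has finitely many smaller neighbours is countably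
  chromatic: colour each vertex with the least natural number not used by them.
\<close>

lemma exists_countable_colouring:
  fixes F :: "'a::wellorder \<Rightarrow> 'a set"
  assumes "\<And>\<alpha>. finite (F \<alpha>)" "\<And>\<alpha>. F \<alpha> \<subseteq> {..<\<alpha>}"
  shows "\<exists>c :: 'a \<Rightarrow> nat. \<forall>\<alpha>. \<forall>\<xi>\<in>F \<alpha>. c \<xi> \<noteq> c \<alpha>"
proof -
  have "\<exists>c :: 'a \<Rightarrow> nat. \<forall>\<alpha>. c \<alpha> \<notin> c ` F \<alpha>"
  proof (rule dependent_wellorder_choice)
    show "(r \<notin> f ` F x) = (r \<notin> g ` F x)" if "\<And>y. y < x \<Longrightarrow> f y = g y" for r :: nat and f g x
    proof -
      have "f ` F x = g ` F x" using that assms(2)[of x] by (intro image_cong) auto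
      then show ?thesis by simp
    qed
  next
    show "\<exists>r. r \<notin> f ` F x" for x and f :: "'a \<Rightarrow> nat"
      using assms(1)[of x] by (intro ex_new_if_finite) auto
  qed
  then obtain c :: "'a \<Rightarrow> nat" where "\<And>\<alpha>. c \<alpha> \<notin> c ` F \<alpha>" by blast
  then show ?thesis by (metis imageI)
qed

text \<open>Inclusion is \<open>\<le>\<^sub>0\<close>, for which (H) bounds the number of predecessors; take an uncountable colour
  class of the resulting comparability graph.\<close>

lemma hausdorff_tower_uncountable_antichain:
  assumes "hausdorff_tower T"
  shows "\<exists>X. uncountable X \<and> (\<forall>\<xi>\<in>X. \<forall>\<alpha>\<in>X. \<xi> < \<alpha> \<longrightarrow> \<not> T \<xi> \<subseteq> T \<alpha>)"
proof -
  obtain e :: "omega1 \<Rightarrow> omega1" where e: "strict_mono e" "condition_H (\<lambda>\<alpha>. T (e \<alpha>))"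
    using assms by (auto simp: hausdorff_tower_def)
  define F where "F \<alpha> = {\<xi>. \<xi> < \<alpha> \<and> T (e \<xi>) \<subseteq> T (e \<alpha>)}" for \<alpha>
  have "F \<alpha> = {\<xi>. \<xi> < \<alpha> \<and> T (e \<xi>) - T (e \<alpha>) \<subseteq> {..<0}}" for \<alpha>
    by (auto simp: F_def)
  then have "finite (F \<alpha>)" for \<alpha>
    using e(2) by (simp only: condition_H_def)
  moreover have "F \<alpha> \<subseteq> {..<\<alpha>}" for \<alpha> by (auto simp: F_def)
  ultimately obtain c :: "omega1 \<Rightarrow> nat" where c: "\<And>\<alpha> \<xi>. \<xi> \<in> F \<alpha> \<Longrightarrow> c \<xi> \<noteq> c \<alpha>"
    using exists_countable_colouring[of F] by blast
  have "(\<Union>k. c -` {k}) = UNIV" by auto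
  then obtain k where k: "uncountable (c -` {k})"
    using uncountable_omega1 countable_UN[of UNIV "\<lambda>k. c -` {k}"] by auto
  have "uncountable (e ` (c -` {k}))"
    using k strict_mono_imp_inj_on[OF e(1)] countable_image_inj_on inj_on_subset by blast
  moreover have "\<not> T (e \<xi>) \<subseteq> T (e \<alpha>)" if "e \<xi> < e \<alpha>" "c \<xi> = k" "c \<alpha> = k" for \<xi> \<alpha>
    using that c[of \<xi> \<alpha>] strict_mono_less[OF e(1)] by (auto simp: F_def)
  ultimately show ?thesis by blast
qed

section \<open>A tower from an unbounded family\<close>

lemma countable_family_dominated:
  fixes h :: "nat \<Rightarrow> nat \<Rightarrow> nat"
  shows "\<exists>g. mono g \<and> (\<forall>i. \<forall>\<^sub>F n in sequentially. h i n < g n)"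
proof (intro exI conjI allI)
  let ?g = "\<lambda>n. Suc (\<Sum>i\<le>n. \<Sum>j\<le>n. h i j)"
  show "mono ?g"
    by (rule monoI) (auto intro!: order_trans[OF sum_mono sum_mono2] sum_mono2)
  show "\<forall>\<^sub>F n in sequentially. h i n < ?g n" for i
  proof (rule eventually_sequentiallyI)
    fix n assume "i \<le> n"
    have "h i n \<le> (\<Sum>j\<le>n. h i j)" by (rule member_le_sum) auto
    also have "\<dots> \<le> (\<Sum>i\<le>n. \<Sum>j\<le>n. h i j)"
      using \<open>i \<le> n\<close> by (intro member_le_sum[of i "{..n}" "\<lambda>i. \<Sum>j\<le>n. h i j"]) auto
    finally show "h i n < ?g n" by simp
  qed
qed

lemma exists_increasing_unbounded_scale:
  fixes \<phi> :: "omega1 \<Rightarrow> nat \<Rightarrow> nat"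
  shows "\<exists>f :: omega1 \<Rightarrow> nat \<Rightarrow> nat. \<forall>\<alpha>. mono (f \<alpha>)
    \<and> (\<forall>\<xi><\<alpha>. \<forall>\<^sub>F n in sequentially. f \<xi> n < f \<alpha> n) \<and> (\<forall>\<^sub>F n in sequentially. \<phi> \<alpha> n < f \<alpha> n)"
proof (rule dependent_wellorder_choice)
  fix x :: omega1 and f :: "omega1 \<Rightarrow> nat \<Rightarrow> nat"
  have "countable (insert (\<phi> x) (f ` {..<x}))"
    using countable_below_omega1 by blast
  then obtain h :: "nat \<Rightarrow> nat \<Rightarrow> nat" where h: "range h = insert (\<phi> x) (f ` {..<x})"
    using uncountable_def by blast
  obtain g where g: "mono g" "\<And>i. \<forall>\<^sub>F n in sequentially. h i n < g n"
    using countable_family_dominated[of h] by blast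
  have "\<forall>\<^sub>F n in sequentially. u n < g n" if "u \<in> insert (\<phi> x) (f ` {..<x})" for u
    using that g(2) h by (metis rangeE)
  then show "\<exists>r. mono r \<and> (\<forall>\<xi><x. \<forall>\<^sub>F n in sequentially. f \<xi> n < r n)
      \<and> (\<forall>\<^sub>F n in sequentially. \<phi> x n < r n)"
    using g(1) by auto
next
  fix f g :: "omega1 \<Rightarrow> nat \<Rightarrow> nat" and x r
  assume "\<And>y. y < x \<Longrightarrow> f y = g y"
  then show "(mono r \<and> (\<forall>\<xi><x. \<forall>\<^sub>F n in sequentially. f \<xi> n < r n)
      \<and> (\<forall>\<^sub>F n in sequentially. \<phi> x n < r n)) \<longleftrightarrow>
    (mono r \<and> (\<forall>\<xi><x. \<forall>\<^sub>F n in sequentially. g \<xi> n < r n)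
      \<and> (\<forall>\<^sub>F n in sequentially. \<phi> x n < r n))"
    by (simp cong: imp_cong)
qed

text \<open>
  Choose a countable \<open>D \<subseteq> X\<close> that realises every initial segment of a function from \<open>X\<close>, and
  \<open>\<gamma>\<close> above \<open>D\<close>. Uncountably many \<open>\<alpha> \<in> X\<close> satisfy \<open>f \<gamma> \<le> f \<alpha>\<close> from one fixed \<open>n\<close> on. They are
  unbounded, so at the least coordinate \<open>i\<close> where infinitely many values occur, infinitely many
  values already occur among the functions with some fixed initial segment below \<open>i\<close>. Let
  \<open>\<xi> \<in> D\<close> have this segment: it lies below \<open>f \<gamma>\<close>, and thus below all these \<open>f \<alpha>\<close>, from some \<open>k\<close>
  on, and between \<open>i\<close> and \<open>k\<close> monotonicity lets a large value \<open>f \<alpha> i\<close> take care of it.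
\<close>

lemma unbounded_scale_no_uncountable_antichain:
  fixes f :: "omega1 \<Rightarrow> nat \<Rightarrow> nat"
  assumes mono: "\<And>\<alpha>. mono (f \<alpha>)"
    and incr: "\<And>\<xi> \<alpha>. \<xi> < \<alpha> \<Longrightarrow> \<forall>\<^sub>F n in sequentially. f \<xi> n \<le> f \<alpha> n"
    and unb: "unbounded_family (range f)"
    and X: "uncountable X"
  shows "\<exists>\<xi>\<in>X. \<exists>\<alpha>\<in>X. \<xi> < \<alpha> \<and> (\<forall>n. f \<xi> n \<le> f \<alpha> n)"
proof -
  define seg where "seg \<alpha> i = map (f \<alpha>) [0..<i]" for \<alpha> i
  define rep where "rep t = (SOME \<xi>. \<xi> \<in> X \<and> seg \<xi> (length t) = t)" for t
  have rep: "rep (seg \<alpha> i) \<in> X" "seg (rep (seg \<alpha> i)) i = seg \<alpha> i" if "\<alpha> \<in> X" for \<alpha> i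
    using someI[of "\<lambda>\<xi>. \<xi> \<in> X \<and> seg \<xi> i = seg \<alpha> i" \<alpha>] that
    by (auto simp: rep_def seg_def)
  obtain \<gamma> where \<gamma>: "\<And>t. rep t < \<gamma>"
    using countable_omega1_bounded[of "range rep"] by (metis countableI_type countable_image rangeI)
  define Y where "Y n = {\<alpha>\<in>X. \<gamma> < \<alpha> \<and> (\<forall>j\<ge>n. f \<gamma> j \<le> f \<alpha> j)}" for n
  have "X \<subseteq> {..\<gamma>} \<union> (\<Union>n. Y n)"
  proof
    fix \<alpha> assume "\<alpha> \<in> X"
    show "\<alpha> \<in> {..\<gamma>} \<union> (\<Union>n. Y n)"
    proof (cases "\<gamma> < \<alpha>")
      case True
      then obtain n where "\<forall>j\<ge>n. f \<gamma> j \<le> f \<alpha> j"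
        using incr[OF True] by (auto simp: eventually_sequentially)
      then have "\<alpha> \<in> Y n" using True \<open>\<alpha> \<in> X\<close> by (simp add: Y_def)
      then show ?thesis by blast
    qed (simp add: not_less)
  qed
  then have "uncountable ({..\<gamma>} \<union> (\<Union>n. Y n))" using X by (meson countable_subset)
  then have "uncountable (\<Union>n. Y n)" using countable_atMost_omega1[of \<gamma>] by auto
  then obtain n where n: "uncountable (Y n)" using countable_UN[of UNIV Y] by auto
  have "\<exists>i. infinite ((\<lambda>\<alpha>. f \<alpha> i) ` Y n)"
  proof (rule ccontr)
    assume "\<not> ?thesis"
    then have "\<exists>b. \<forall>\<alpha>\<in>Y n. f \<alpha> i \<le> b" for i
      by (auto simp: finite_nat_set_iff_bounded_le)
    then obtain g where g: "\<And>\<alpha> i. \<alpha> \<in> Y n \<Longrightarrow> f \<alpha> i \<le> g i" by metis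
    have "\<forall>\<^sub>F j in sequentially. f \<xi> j \<le> g j" for \<xi>
    proof -
      obtain \<alpha> where "\<alpha> \<in> Y n" "\<xi> < \<alpha>" using uncountable_omega1_cofinal[OF n] by blast
      then show ?thesis
        using eventually_mono[OF incr[OF \<open>\<xi> < \<alpha>\<close>]] g[OF \<open>\<alpha> \<in> Y n\<close>] by (meson order_trans)
    qed
    then show False using unb by (auto simp: unbounded_family_def)
  qed
  then obtain i where i: "infinite ((\<lambda>\<alpha>. f \<alpha> i) ` Y n)"
      and least: "\<And>j. j < i \<Longrightarrow> finite ((\<lambda>\<alpha>. f \<alpha> j) ` Y n)"
    using exists_least_iff[of "\<lambda>i. infinite ((\<lambda>\<alpha>. f \<alpha> i) ` Y n)"] by blast
  define V where "V = (\<Union>j<i. (\<lambda>\<alpha>. f \<alpha> j) ` Y n)"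
  have "finite V" using least by (auto simp: V_def)
  then have "finite {t. set t \<subseteq> V \<and> length t = i}" by (rule finite_lists_length_eq)
  moreover have "(\<lambda>\<alpha>. seg \<alpha> i) ` Y n \<subseteq> {t. set t \<subseteq> V \<and> length t = i}"
    by (fastforce simp: seg_def V_def)
  ultimately have fin: "finite ((\<lambda>\<alpha>. seg \<alpha> i) ` Y n)" by (meson finite_subset)
  have "\<exists>t \<in> (\<lambda>\<alpha>. seg \<alpha> i) ` Y n. infinite ((\<lambda>\<alpha>. f \<alpha> i) ` {\<alpha>\<in>Y n. seg \<alpha> i = t})"
  proof (rule ccontr)
    assume "\<not> ?thesis"
    then have "finite (\<Union>t \<in> (\<lambda>\<alpha>. seg \<alpha> i) ` Y n. (\<lambda>\<alpha>. f \<alpha> i) ` {\<alpha>\<in>Y n. seg \<alpha> i = t})"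
      using fin by blast
    moreover have "(\<lambda>\<alpha>. f \<alpha> i) ` Y n \<subseteq>
        (\<Union>t \<in> (\<lambda>\<alpha>. seg \<alpha> i) ` Y n. (\<lambda>\<alpha>. f \<alpha> i) ` {\<alpha>\<in>Y n. seg \<alpha> i = t})"
      by blast
    ultimately show False using i by (meson finite_subset)
  qed
  then obtain \<alpha>0 where \<alpha>0: "\<alpha>0 \<in> Y n"
      and inf: "infinite ((\<lambda>\<alpha>. f \<alpha> i) ` {\<alpha>\<in>Y n. seg \<alpha> i = seg \<alpha>0 i})"
    by blast
  define \<xi> where "\<xi> = rep (seg \<alpha>0 i)"
  have \<xi>: "\<xi> \<in> X" "seg \<xi> i = seg \<alpha>0 i" "\<xi> < \<gamma>"
    using rep[of \<alpha>0 i] \<alpha>0 \<gamma> by (auto simp: \<xi>_def Y_def)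
  obtain k0 where k0: "\<And>j. j \<ge> k0 \<Longrightarrow> f \<xi> j \<le> f \<gamma> j"
    using incr[OF \<xi>(3)] by (auto simp: eventually_sequentially)
  \<comment> \<open>From \<open>k\<close> on, \<open>f \<xi> \<le> f \<gamma> \<le> f \<alpha>\<close> for all \<open>\<alpha> \<in> Y n\<close>.\<close>
  define k where "k = max k0 n"
  obtain \<alpha> where \<alpha>: "\<alpha> \<in> Y n" "seg \<alpha> i = seg \<alpha>0 i" "f \<xi> k < f \<alpha> i"
    using inf by (auto simp: infinite_nat_iff_unbounded)
  have "f \<xi> j \<le> f \<alpha> j" for j
  proof -
    consider "j < i" | "i \<le> j" "j \<le> k" | "k \<le> j" by linarith
    then show ?thesis
    proof cases
      case 1
      have "map (f \<xi>) [0..<i] = map (f \<alpha>) [0..<i]" using \<xi>(2) \<alpha>(2) by (simp add: seg_def)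
      then show ?thesis using 1 by simp
    next
      case 2
      have "f \<xi> j \<le> f \<xi> k" using 2(2) mono monoD by blast
      also have "\<dots> \<le> f \<alpha> i" using \<alpha>(3) by simp
      also have "\<dots> \<le> f \<alpha> j" using 2(1) mono monoD by blast
      finally show ?thesis .
    next
      case 3
      then have "f \<xi> j \<le> f \<gamma> j" "f \<gamma> j \<le> f \<alpha> j"
        using k0 \<alpha>(1) by (auto simp: k_def Y_def)
      then show ?thesis by simp
    qed
  qed
  moreover have "\<alpha> \<in> X" "\<xi> < \<alpha>" using \<alpha>(1) \<xi>(3) by (auto simp: Y_def)
  ultimately show ?thesis using \<xi>(1) by blast
qed

definition undergraph :: "(nat \<Rightarrow> nat) \<Rightarrow> nat set" where
  "undergraph f = {p. snd (prod_decode p) < f (fst (prod_decode p))}"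

lemma prod_encode_in_undergraph [simp]: "prod_encode (i, j) \<in> undergraph f \<longleftrightarrow> j < f i"
  by (simp add: undergraph_def)

lemma undergraph_subset_iff: "undergraph f \<subseteq> undergraph g \<longleftrightarrow> (\<forall>n. f n \<le> g n)"
proof
  assume sub: "undergraph f \<subseteq> undergraph g"
  show "\<forall>n. f n \<le> g n"
  proof (rule allI, rule ccontr)
    fix n assume "\<not> f n \<le> g n"
    then have "prod_encode (n, g n) \<in> undergraph f" by simp
    then have "prod_encode (n, g n) \<in> undergraph g" using sub by blast
    then show False by simp
  qed
next
  assume "\<forall>n. f n \<le> g n"
  then show "undergraph f \<subseteq> undergraph g"
    by (auto simp: undergraph_def intro: less_le_trans)
qed

lemma finite_undergraph_diff_iff:
  "finite (undergraph f - undergraph g) \<longleftrightarrow> (\<forall>\<^sub>F n in sequentially. f n \<le> g n)"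
proof -
  have "finite (undergraph f - undergraph g) \<longleftrightarrow> finite {n. \<not> f n \<le> g n}"
  proof
    assume fin: "finite (undergraph f - undergraph g)"
    have "n \<in> (fst \<circ> prod_decode) ` (undergraph f - undergraph g)" if "\<not> f n \<le> g n" for n
      using that by (intro image_eqI[of _ _ "prod_encode (n, g n)"]) auto
    then have "{n. \<not> f n \<le> g n} \<subseteq> (fst \<circ> prod_decode) ` (undergraph f - undergraph g)"
      by blast
    then show "finite {n. \<not> f n \<le> g n}" by (rule finite_surj[OF fin])
  next
    assume fin: "finite {n. \<not> f n \<le> g n}"
    have "undergraph f - undergraph g \<subseteq>
        prod_encode ` (SIGMA n:{n. \<not> f n \<le> g n}. {..<f n})"
    proof
      fix p assume p: "p \<in> undergraph f - undergraph g"
      obtain i j where "p = prod_encode (i, j)" by (metis prod_decode_inverse surj_pair)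
      then show "p \<in> prod_encode ` (SIGMA n:{n. \<not> f n \<le> g n}. {..<f n})"
        using p by (auto intro!: imageI)
    qed
    moreover have "finite (SIGMA n:{n. \<not> f n \<le> g n}. {..<f n})"
      using fin by (intro finite_SigmaI) auto
    ultimately show "finite (undergraph f - undergraph g)"
      by (meson finite_surj)
  qed
  then show ?thesis
    by (simp add: cofinite_eq_sequentially[symmetric] eventually_cofinite)
qed

lemma exists_non_hausdorff_tower:
  fixes \<phi> :: "omega1 \<Rightarrow> nat \<Rightarrow> nat"
  assumes unb: "unbounded_family (range \<phi>)"
  shows "\<exists>T. omega1_tower T \<and> \<not> hausdorff_tower T"
proof -
  obtain f :: "omega1 \<Rightarrow> nat \<Rightarrow> nat" where f: "\<And>\<alpha>. mono (f \<alpha>)"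
      "\<And>\<xi> \<alpha>. \<xi> < \<alpha> \<Longrightarrow> \<forall>\<^sub>F n in sequentially. f \<xi> n < f \<alpha> n"
      "\<And>\<alpha>. \<forall>\<^sub>F n in sequentially. \<phi> \<alpha> n < f \<alpha> n"
    using exists_increasing_unbounded_scale[of \<phi>] by blast
  have incr: "\<forall>\<^sub>F n in sequentially. f \<xi> n \<le> f \<alpha> n" if "\<xi> < \<alpha>" for \<xi> \<alpha>
    using f(2)[OF that] by (rule eventually_mono) simp
  have unb_f: "unbounded_family (range f)"
    unfolding unbounded_family_def
  proof
    assume "\<exists>g. \<forall>u\<in>range f. \<forall>\<^sub>F n in sequentially. u n \<le> g n"
    then obtain g where g: "\<And>\<alpha>. \<forall>\<^sub>F n in sequentially. f \<alpha> n \<le> g n" by blast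
    have "\<forall>\<^sub>F n in sequentially. \<phi> \<alpha> n \<le> g n" for \<alpha>
      using f(3)[of \<alpha>] g[of \<alpha>] by eventually_elim simp
    then show False using unb by (auto simp: unbounded_family_def)
  qed
  let ?T = "\<lambda>\<alpha>. undergraph (f \<alpha>)"
  have "(\<forall>\<^sub>F n in sequentially. f \<alpha> n \<le> f \<beta> n) \<longleftrightarrow> \<alpha> \<le> \<beta>" for \<alpha> \<beta>
  proof
    assume le: "\<forall>\<^sub>F n in sequentially. f \<alpha> n \<le> f \<beta> n"
    show "\<alpha> \<le> \<beta>"
    proof (rule ccontr)
      assume "\<not> \<alpha> \<le> \<beta>"
      then have "\<forall>\<^sub>F n in sequentially. f \<beta> n < f \<alpha> n" using f(2) by simp
      with le have "\<forall>\<^sub>F n in sequentially. False" by eventually_elim simp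
      then show False by simp
    qed
  next
    assume "\<alpha> \<le> \<beta>"
    then show "\<forall>\<^sub>F n in sequentially. f \<alpha> n \<le> f \<beta> n"
      using incr by (cases "\<alpha> = \<beta>") auto
  qed
  then have "omega1_tower ?T"
    by (simp add: omega1_tower_def finite_undergraph_diff_iff)
  moreover have "\<not> hausdorff_tower ?T"
  proof
    assume "hausdorff_tower ?T"
    from hausdorff_tower_uncountable_antichain[OF this] obtain X where X: "uncountable X"
        "\<forall>\<xi>\<in>X. \<forall>\<alpha>\<in>X. \<xi> < \<alpha> \<longrightarrow> \<not> (\<forall>n. f \<xi> n \<le> f \<alpha> n)"
      unfolding undergraph_subset_iff by (elim exE conjE)
    then show False
      using unbounded_scale_no_uncountable_antichain[OF f(1) incr unb_f X(1)] by meson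
  qed
  ultimately show ?thesis by blast
qed

section \<open>The equivalence\<close>

theorem theorem23:
  assumes "PID"
  shows "(\<forall>T. omega1_tower T \<longrightarrow> hausdorff_tower T) \<longleftrightarrow> cardSuc natLeq <o bounding_number"
  unfolding omega1_less_bounding_number_iff
proof
  assume "\<forall>T. omega1_tower T \<longrightarrow> hausdorff_tower T"
  then show "\<forall>\<phi> :: omega1 \<Rightarrow> nat \<Rightarrow> nat. \<not> unbounded_family (range \<phi>)"
    using exists_non_hausdorff_tower by metis
next
  assume "\<forall>\<phi> :: omega1 \<Rightarrow> nat \<Rightarrow> nat. \<not> unbounded_family (range \<phi>)"
  then show "\<forall>T. omega1_tower T \<longrightarrow> hausdorff_tower T"
    using hausdorff_tower_of_PID[OF assms] by simp
qed

end
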